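(* Let $p\in\mathbb{R}[x_1,\dots,x_n]$ be a nonzero sum-of-squares polynomial, let $N=\left|\tfrac12 N(p)\right|$, and let $\omega>0$. Assume that solving one semidefinite program with a basis of size $m$ costs $c(m)=\Theta(m^\omega)$, i.e. there are constants $0<a\le b$ with $a\,m^\omega\le c(m)\le b\,m^\omega$ for all integers $m\ge 1$. Let $B_{\mathrm{cov}}\subseteq\tfrac12 N(p)$ be the coverage-repaired basis and set $m_1=|B_{\mathrm{cov}}|\ge 1$. Let $\nu=(u_1,\dots,u_N)$ be an ordering of $\tfrac12 N(p)$ whose first $m_1$ entries are the elements of $B_{\mathrm{cov}}$, and let $\eta$ be the coverage rank of $\nu$, with $m_1\le\eta$. Let $\rho>1$ and run the ordered expansion procedure with the geometric schedule $m_{i+1}=\min\{N,\lceil\rho\, m_i\rceil\}$. Then the procedure performs at most $$1+\left\lceil \log_\rho(\eta/m_1)\right\rceil$$ semidefinite program solves (counting the solve of size $m_1$), and its total cost (the sum of $c(m_i)$ over the solves performed) is $$O\!\left(\frac{\rho^{\omega}}{1-\rho^{-\omega}}\,\eta^{\omega}\right),$$ where the implied constant depends only on the constants $a,b$ in the cost model.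
   Context: Monomials $\mathbf{x}^\alpha$ are identified with their exponent vectors $\alpha\in\mathbb{Z}_{\ge0}^n$. $S(p)$ is the set of monomials appearing in $p$ with nonzero coefficient, and the Newton polytope $N(p)\subset\mathbb{R}^n$ is the convex hull of the exponent vectors of $S(p)$. The half Newton polytope is $N(p)$ scaled by $1/2$ about the origin; as a candidate set of monomials, $\tfrac12 N(p)$ denotes the finite set $\{\mathbf{x}^\alpha:\alpha\in(\tfrac12N(p))\cap\mathbb{Z}_{\ge0}^n\}$, and $|\tfrac12 N(p)|$ is its cardinality. (It is a known fact that if $p$ is a sum of squares then this set is an SOS basis of $p$.) For a finite set $B$ of monomials, $\mathbf{z}_B(\mathbf{x})$ is the vector of its elements. $B$ is an SOS basis of $p$ if $p(\mathbf{x})=\mathbf{z}_B(\mathbf{x})^\top Q\,\mathbf{z}_B(\mathbf{x})$ for some positive semidefinite real symmetric matrix $Q$. The semidefinite program for $(B,p)$ asks for such a $Q$; it is feasible iff $B$ is an SOS basis of $p$, and its size is $|B|$. A coverage-repaired basis $B_{\mathrm{cov}}$ is a set of monomials with $S(p)\subseteq\{m m' : m,m'\in B_{\mathrm{cov}}\}$. Given an ordering $\nu=(u_1,\dots,u_N)$ of $\tfrac12N(p)$, the coverage rank $\eta$ is the smallest index $j$ such that $\{u_1,\dots,u_j\}$ is an SOS basis of $p$. Ordered expansion procedure with schedule $m_1<m_2<\cdots<m_k=N$: for $t=1,2,\dots,k$ in turn, solve the semidefinite program for $(\{u_1,\dots,u_{m_t}\},p)$; stop as soon as one is feasible. Only the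 cost of semidefinite program solves is counted. *)

theory Defs
  imports "HOL-Analysis.Analysis" "HOL-Analysis.Finite_Function_Topology"
begin

text \<open>
  A monomial \<open>x\<^sup>\<alpha>\<close> is its exponent vector \<open>\<alpha> :: nat \<Rightarrow>\<^sub>0 nat\<close>, and a real polynomial is the
  finitely supported map from monomials to coefficients (so multiplication is the convolution
  product).  The variables \<open>x\<^sub>1, \<dots>, x\<^sub>n\<close> carry the indices \<open>0, \<dots>, n - 1\<close>.  The number \<open>n\<close> is
  a natural number and not a type, so that a constant can be chosen uniformly in \<open>n\<close>.
\<close>

type_synonym expo = "nat \<Rightarrow>\<^sub>0 nat"
type_synonym rpoly = "expo \<Rightarrow>\<^sub>0 real"

definition monomials :: "nat \<Rightarrow> expo set" where
  "monomials n = {\<alpha>. Poly_Mapping.keys \<alpha> \<subseteq> {..<n}}"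

definition polys :: "nat \<Rightarrow> rpoly set" where
  "polys n = {p. Poly_Mapping.keys p \<subseteq> monomials n}"

abbreviation mono_support :: "rpoly \<Rightarrow> expo set" where
  "mono_support p \<equiv> Poly_Mapping.keys p"

definition sum_of_squares :: "nat \<Rightarrow> rpoly \<Rightarrow> bool" where
  "sum_of_squares n p \<longleftrightarrow>
     (\<exists>(k::nat) q. (\<forall>i<k. q i \<in> polys n) \<and> p = (\<Sum>i<k. (q i)^2))"

text \<open>
  Real vectors are finitely supported maps \<open>nat \<Rightarrow>\<^sub>0 real\<close>; \<open>\<real>\<^sup>n\<close> is the subspace of those
  supported on \<open>{..<n}\<close>, and it contains the Newton polytope of every member of \<open>polys n\<close>.
\<close>

definition real_expo :: "expo \<Rightarrow> (nat \<Rightarrow>\<^sub>0 real)" where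
  "real_expo \<alpha> = Poly_Mapping.map real \<alpha>"

definition newton_polytope :: "rpoly \<Rightarrow> (nat \<Rightarrow>\<^sub>0 real) set" where
  "newton_polytope p = convex hull (real_expo ` mono_support p)"

definition half_newton :: "nat \<Rightarrow> rpoly \<Rightarrow> expo set" where
  "half_newton n p =
     {\<alpha> \<in> monomials n. real_expo \<alpha> \<in> (\<lambda>v. (1/2) *\<^sub>R v) ` newton_polytope p}"

text \<open>Square matrices indexed by a finite set \<open>B\<close>; entries outside \<open>B \<times> B\<close> are irrelevant.\<close>

definition psd_on :: "'a set \<Rightarrow> ('a \<Rightarrow> 'a \<Rightarrow> real) \<Rightarrow> bool" where
  "psd_on B Q \<longleftrightarrow>
     (\<forall>\<alpha>\<in>B. \<forall>\<beta>\<in>B. Q \<alpha> \<beta> = Q \<beta> \<alpha>) \<and>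
     (\<forall>v. 0 \<le> (\<Sum>\<alpha>\<in>B. \<Sum>\<beta>\<in>B. v \<alpha> * Q \<alpha> \<beta> * v \<beta>))"

definition mono_poly :: "expo \<Rightarrow> rpoly" where
  "mono_poly \<alpha> = Poly_Mapping.single \<alpha> 1"

definition const_poly :: "real \<Rightarrow> rpoly" where
  "const_poly r = Poly_Mapping.single 0 r"

definition sos_basis :: "rpoly \<Rightarrow> expo set \<Rightarrow> bool" where
  "sos_basis p B \<longleftrightarrow> finite B \<and>
     (\<exists>Q. psd_on B Q \<and>
          p = (\<Sum>\<alpha>\<in>B. \<Sum>\<beta>\<in>B. mono_poly \<alpha> * const_poly (Q \<alpha> \<beta>) * mono_poly \<beta>))"

text \<open>Addition of exponent vectors is multiplication of monomials.\<close>

definition coverage_repaired :: "rpoly \<Rightarrow> expo set \<Rightarrow> bool" where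
  "coverage_repaired p B \<longleftrightarrow> mono_support p \<subseteq> {\<alpha> + \<beta> |\<alpha> \<beta>. \<alpha> \<in> B \<and> \<beta> \<in> B}"

definition coverage_rank :: "rpoly \<Rightarrow> expo list \<Rightarrow> nat" where
  "coverage_rank p u = (LEAST j. 1 \<le> j \<and> j \<le> length u \<and> sos_basis p (set (take j u)))"

definition geometric_schedule :: "nat \<Rightarrow> real \<Rightarrow> nat \<Rightarrow> nat list \<Rightarrow> bool" where
  "geometric_schedule N \<rho> m1 ms \<longleftrightarrow>
     ms \<noteq> [] \<and> hd ms = m1 \<and> last ms = N \<and> sorted_wrt (<) ms \<and>
     (\<forall>i. Suc i < length ms \<longrightarrow> ms ! Suc i = min N (nat \<lceil>\<rho> * real (ms ! i)\<rceil>))"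

lemma geometric_schedule_exists:
  assumes "1 < \<rho>" "1 \<le> m1" "m1 \<le> N"
  shows "\<exists>ms. geometric_schedule N \<rho> m1 ms"
  using assms(2,3)
proof (induction "N - m1" arbitrary: m1 rule: less_induct)
  case less
  show ?case
  proof (cases "m1 = N")
    case True
    then have "geometric_schedule N \<rho> m1 [m1]"
      by (simp add: geometric_schedule_def)
    then show ?thesis ..
  next
    case False
    define m2 where "m2 = min N (nat \<lceil>\<rho> * real m1\<rceil>)"
    have "real m1 < \<rho> * real m1"
      using assms(1) less.prems(1) by simp
    then have "m1 < nat \<lceil>\<rho> * real m1\<rceil>"
      by linarith
    then have m2: "m1 < m2" "m2 \<le> N"
      using False less.prems by (auto simp: m2_def)
    then obtain ms where ms: "geometric_schedule N \<rho> m2 ms"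
      using less.hyps[of m2] less.prems by force
    then obtain ms' where ms': "ms = m2 # ms'"
      by (cases ms) (auto simp: geometric_schedule_def)
    have "geometric_schedule N \<rho> m1 (m1 # ms)"
      unfolding geometric_schedule_def
    proof (intro conjI allI impI)
      show "last (m1 # ms) = N"
        using ms by (simp add: geometric_schedule_def)
      show "sorted_wrt (<) (m1 # ms)"
        using ms m2(1) ms' by (auto simp: geometric_schedule_def)
      fix i assume i: "Suc i < length (m1 # ms)"
      show "(m1 # ms) ! Suc i = min N (nat \<lceil>\<rho> * real ((m1 # ms) ! i)\<rceil>)"
      proof (cases i)
        case 0
        then show ?thesis
          using ms ms' by (simp add: geometric_schedule_def m2_def)
      next
        case (Suc j)
        then show ?thesis
          using ms i by (simp add: geometric_schedule_def)
      qed
    qed simp_all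
    then show ?thesis ..
  qed
qed

text \<open>
  The sizes of the semidefinite programs that the ordered expansion procedure solves, in order.
  The program for \<open>(B, p)\<close> is feasible iff \<open>sos_basis p B\<close>; the last size listed is the first
  feasible one, or the end of the schedule if none is feasible.
\<close>

primrec expansion_solves :: "rpoly \<Rightarrow> expo list \<Rightarrow> nat list \<Rightarrow> nat list" where
  "expansion_solves p u [] = []"
| "expansion_solves p u (m # ms) =
     m # (if sos_basis p (set (take m u)) then [] else expansion_solves p u ms)"

end

theory Submission
  imports Defs
begin

text \<open>
  If \<open>p = \<Sum>\<^sub>i q\<^sub>i\<^sup>2\<close> and \<open>\<sigma>\<close> is an extreme point of the union \<open>K\<close> of the supports of the \<open>q\<^sub>i\<close>, then
  \<open>2\<sigma>\<close> is a sum of two elements of \<open>K\<close> in one way only, so its coefficient in \<open>p\<close> is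
  \<open>\<Sum>\<^sub>i q\<^sub>i(\<sigma>)\<^sup>2 > 0\<close>.  Hence \<open>K\<close> lies in the half Newton polytope, the Gram matrix of the \<open>q\<^sub>i\<close> makes
  the latter an SOS basis, and a prefix of length \<open>m\<close> of the ordering is feasible iff \<open>m \<ge> \<eta>\<close>.
  Before the last solve the sizes are below \<open>\<eta>\<close> and grow at least by the factor \<open>\<rho>\<close>, which
  bounds their number by a logarithm and their cost by a geometric series; the last size is at most
  \<open>\<lceil>\<rho> (\<eta> - 1)\<rceil> \<le> \<rho> \<eta>\<close>.
\<close>

section \<open>Supports of sums of squares\<close>

text \<open>Among the subsets of \<open>K\<close> whose hull contains \<open>K\<close>, one of least
  cardinality has no point in the hull of its other points. This plays the role of extremality in
  any real vector space: if \<open>x + y = s + s\<close>, then \<open>x\<close> and \<open>y\<close>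
  are mixtures of \<open>s\<close> and points of the other hull, and any weight on the latter would
  put \<open>s\<close> into it.\<close>

lemma finite_extreme_subset:
  fixes K :: "'a::real_vector set"
  assumes "finite K"
  obtains S where "S \<subseteq> K" "K \<subseteq> convex hull S"
    "\<And>s x y. s \<in> S \<Longrightarrow> x \<in> K \<Longrightarrow> y \<in> K \<Longrightarrow> x + y = s + s \<Longrightarrow> x = s \<and> y = s"
proof -
  define P where "P S \<longleftrightarrow> S \<subseteq> K \<and> K \<subseteq> convex hull S" for S
  have "P K"
    by (simp add: P_def hull_subset)
  then obtain S where S: "P S" and min: "\<And>T. P T \<Longrightarrow> card S \<le> card T"
    using ex_has_least_nat[of P K card] by blast
  have fin: "finite S"
    using S assms finite_subset by (auto simp: P_def)
  have indep: "s \<notin> convex hull (S - {s})" if "s \<in> S" for s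
  proof
    assume "s \<in> convex hull (S - {s})"
    then have "S \<subseteq> convex hull (S - {s})"
      using hull_subset[of "S - {s}" convex] by blast
    then have "convex hull S \<subseteq> convex hull (S - {s})"
      by (simp add: hull_minimal)
    then have "P (S - {s})"
      using S by (auto simp: P_def)
    then have "card S \<le> card (S - {s})"
      by (rule min)
    then show False
      using that fin card_Diff1_less[of S s] by simp
  qed
  show thesis
  proof
    show "S \<subseteq> K" "K \<subseteq> convex hull S"
      using S by (auto simp: P_def)
    fix s x y assume s: "s \<in> S" and "x \<in> K" "y \<in> K" and eq: "x + y = s + s"
    let ?T = "S - {s}"
    have x: "x \<in> convex hull (insert s ?T)" and y: "y \<in> convex hull (insert s ?T)"
      using S s \<open>x \<in> K\<close> \<open>y \<in> K\<close> by (auto simp: P_def insert_absorb)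
    show "x = s \<and> y = s"
    proof (cases "?T = {}")
      case True
      show ?thesis using x y unfolding True by simp
    next
      case False
      obtain u x' where u: "0 \<le> u" "x' \<in> convex hull ?T" "x = (1 - u) *\<^sub>R s + u *\<^sub>R x'"
        using x False unfolding convex_hull_insert_alt by auto
      obtain v y' where v: "0 \<le> v" "y' \<in> convex hull ?T" "y = (1 - v) *\<^sub>R s + v *\<^sub>R y'"
        using y False unfolding convex_hull_insert_alt by auto
      have sum: "(u + v) *\<^sub>R s = u *\<^sub>R x' + v *\<^sub>R y'"
        using eq u(3) v(3) by (simp add: algebra_simps)
      have "u + v = 0"
      proof (rule ccontr)
        assume nz: "u + v \<noteq> 0"
        \<comment> \<open>Both weights are nonnegative, so normalising by \<open>u + v\<close> turns
          the identity into a convex combination of \<open>x'\<close> and \<open>y'\<close>.\<close>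
        have "s = (1 / (u + v)) *\<^sub>R ((u + v) *\<^sub>R s)"
          using nz by simp
        also have "\<dots> = (u / (u + v)) *\<^sub>R x' + (v / (u + v)) *\<^sub>R y'"
          unfolding sum by (simp add: scaleR_add_right)
        also have "\<dots> \<in> convex hull ?T"
          using u v nz
          by (intro convexD[OF convex_convex_hull]) (auto simp: add_divide_distrib[symmetric])
        finally show False
          using indep[OF s] by simp
      qed
      then have "u = 0" "v = 0"
        using u v by auto
      then show ?thesis
        using u v by simp
    qed
  qed
qed

section \<open>Exponent vectors and coefficients of squares\<close>

lemma lookup_real_expo [simp]:
  "Poly_Mapping.lookup (real_expo \<alpha>) i = real (Poly_Mapping.lookup \<alpha> i)"
  by (simp add: real_expo_def Poly_Mapping.map.rep_eq when_def)

lemma real_expo_add: "real_expo (\<alpha> + \<beta>) = real_expo \<alpha> + real_expo \<beta>"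
  by (rule poly_mapping_eqI) (simp add: lookup_add)

lemma inj_real_expo: "inj real_expo"
proof (rule injI)
  fix \<alpha> \<beta> assume "real_expo \<alpha> = real_expo \<beta>"
  then have "real (Poly_Mapping.lookup \<alpha> i) = real (Poly_Mapping.lookup \<beta> i)" for i
    by (metis lookup_real_expo)
  then show "\<alpha> = \<beta>"
    by (intro poly_mapping_eqI) simp
qed

text \<open>\<open>A\<close> may exceed the support, so that several polynomials can be expanded
  over one common index set.\<close>

lemma poly_mapping_sum_single:
  assumes "finite A" "Poly_Mapping.keys f \<subseteq> A"
  shows "f = (\<Sum>\<alpha>\<in>A. Poly_Mapping.single \<alpha> (Poly_Mapping.lookup f \<alpha>))"
proof (rule poly_mapping_eqI)
  fix k
  have "(\<Sum>\<alpha>\<in>A. Poly_Mapping.lookup (Poly_Mapping.single \<alpha> (Poly_Mapping.lookup f \<alpha>)) k) =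
        (\<Sum>\<alpha>\<in>A. if \<alpha> = k then Poly_Mapping.lookup f k else 0)"
    by (intro sum.cong) (auto simp: lookup_single when_def)
  also have "\<dots> = Poly_Mapping.lookup f k"
    using assms by (auto simp: in_keys_iff)
  finally show "Poly_Mapping.lookup f k =
      Poly_Mapping.lookup (\<Sum>\<alpha>\<in>A. Poly_Mapping.single \<alpha> (Poly_Mapping.lookup f \<alpha>)) k"
    by (simp add: lookup_sum)
qed

lemma square_expand:
  fixes f :: rpoly
  assumes "finite A" "Poly_Mapping.keys f \<subseteq> A"
  shows "f\<^sup>2 = (\<Sum>\<alpha>\<in>A. \<Sum>\<beta>\<in>A.
    Poly_Mapping.single (\<alpha> + \<beta>) (Poly_Mapping.lookup f \<alpha> * Poly_Mapping.lookup f \<beta>))"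
proof -
  let ?g = "\<Sum>\<alpha>\<in>A. Poly_Mapping.single \<alpha> (Poly_Mapping.lookup f \<alpha>)"
  have "f\<^sup>2 = ?g * ?g"
    using poly_mapping_sum_single[OF assms] by (simp add: power2_eq_square)
  then show ?thesis
    by (simp add: sum_product mult_single)
qed

text \<open>Only the pair \<open>(\<sigma>, \<sigma>)\<close> contributes to this coefficient, so no
  cross term can cancel the square.\<close>

lemma lookup_square_unique:
  fixes f :: rpoly
  assumes "finite A" "Poly_Mapping.keys f \<subseteq> A" "\<sigma> \<in> A"
    and "\<And>\<alpha> \<beta>. \<alpha> \<in> A \<Longrightarrow> \<beta> \<in> A \<Longrightarrow> \<alpha> + \<beta> = \<sigma> + \<sigma> \<Longrightarrow> \<alpha> = \<sigma> \<and> \<beta> = \<sigma>"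
  shows "Poly_Mapping.lookup (f\<^sup>2) (\<sigma> + \<sigma>) = (Poly_Mapping.lookup f \<sigma>)\<^sup>2"
proof -
  let ?l = "Poly_Mapping.lookup f"
  have "Poly_Mapping.lookup (f\<^sup>2) (\<sigma> + \<sigma>) =
      (\<Sum>\<alpha>\<in>A. \<Sum>\<beta>\<in>A. if \<alpha> + \<beta> = \<sigma> + \<sigma> then ?l \<alpha> * ?l \<beta> else 0)"
    unfolding square_expand[OF assms(1,2)] by (simp add: lookup_sum lookup_single when_def)
  \<comment> \<open>The nested conditionals let both sums collapse one after the other.\<close>
  also have "\<dots> = (\<Sum>\<alpha>\<in>A. \<Sum>\<beta>\<in>A. if \<beta> = \<sigma> then (if \<alpha> = \<sigma> then (?l \<sigma>)\<^sup>2 else 0) else 0)"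
  proof (intro sum.cong refl)
    fix \<alpha> \<beta> assume "\<alpha> \<in> A" "\<beta> \<in> A"
    then have "\<alpha> + \<beta> = \<sigma> + \<sigma> \<longleftrightarrow> \<alpha> = \<sigma> \<and> \<beta> = \<sigma>"
      using assms(4) by blast
    then show "(if \<alpha> + \<beta> = \<sigma> + \<sigma> then ?l \<alpha> * ?l \<beta> else 0) =
        (if \<beta> = \<sigma> then (if \<alpha> = \<sigma> then (?l \<sigma>)\<^sup>2 else 0) else 0)"
      by (simp add: power2_eq_square)
  qed
  also have "\<dots> = (?l \<sigma>)\<^sup>2"
    using assms(1,3) by simp
  finally show ?thesis .
qed

text \<open>Coefficients of \<open>p\<close> at doubled extreme exponents of the joint support are
  sums of real squares and hence survive. Convexity then carries the inclusion from the extreme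
  exponents to the whole support.\<close>

lemma keys_subset_half_newton:
  fixes k :: nat and q :: "nat \<Rightarrow> rpoly"
  assumes q: "\<And>i. i < k \<Longrightarrow> q i \<in> polys n" and p: "p = (\<Sum>i<k. (q i)\<^sup>2)" and j: "j < k"
  shows "Poly_Mapping.keys (q j) \<subseteq> half_newton n p"
proof -
  define K where "K = (\<Union>i<k. Poly_Mapping.keys (q i))"
  have fin: "finite K"
    by (simp add: K_def)
  obtain S where S: "S \<subseteq> real_expo ` K" "real_expo ` K \<subseteq> convex hull S"
    and ext: "\<And>s x y. s \<in> S \<Longrightarrow> x \<in> real_expo ` K \<Longrightarrow> y \<in> real_expo ` K \<Longrightarrow> x + y = s + s \<Longrightarrow>
      x = s \<and> y = s"
    using finite_extreme_subset[of "real_expo ` K"] fin by blast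
  let ?H = "(\<lambda>v. (1/2) *\<^sub>R v) ` newton_polytope p"
  have "s \<in> ?H" if s: "s \<in> S" for s
  proof -
    obtain \<sigma> where \<sigma>: "\<sigma> \<in> K" "s = real_expo \<sigma>"
      using S(1) s by blast
    \<comment> \<open>Extremality holds for real vectors; injectivity of \<open>real_expo\<close>
      brings it back to exponents.\<close>
    have unique: "\<alpha> = \<sigma> \<and> \<beta> = \<sigma>" if "\<alpha> \<in> K" "\<beta> \<in> K" "\<alpha> + \<beta> = \<sigma> + \<sigma>" for \<alpha> \<beta>
      using ext[OF s, of "real_expo \<alpha>" "real_expo \<beta>"] that \<sigma>
      by (metis imageI inj_real_expo injD real_expo_add)
    have "Poly_Mapping.lookup p (\<sigma> + \<sigma>) = (\<Sum>i<k. (Poly_Mapping.lookup (q i) \<sigma>)\<^sup>2)"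
      unfolding p lookup_sum
    proof (intro sum.cong refl)
      fix i assume "i \<in> {..<k}"
      then show "Poly_Mapping.lookup ((q i)\<^sup>2) (\<sigma> + \<sigma>) = (Poly_Mapping.lookup (q i) \<sigma>)\<^sup>2"
        by (intro lookup_square_unique[OF fin _ \<sigma>(1) unique]) (auto simp: K_def)
    qed
    moreover obtain i where "i < k" "Poly_Mapping.lookup (q i) \<sigma> \<noteq> 0"
      using \<sigma>(1) by (auto simp: K_def in_keys_iff)
    then have "0 < (\<Sum>i<k. (Poly_Mapping.lookup (q i) \<sigma>)\<^sup>2)"
      by (intro sum_pos2[of _ i]) auto
    ultimately have "\<sigma> + \<sigma> \<in> Poly_Mapping.keys p"
      by (simp add: in_keys_iff)
    then have "real_expo (\<sigma> + \<sigma>) \<in> newton_polytope p"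
      unfolding newton_polytope_def by (intro hull_inc imageI)
    moreover have "s = (1/2) *\<^sub>R real_expo (\<sigma> + \<sigma>)"
      by (simp add: \<sigma> real_expo_add flip: scaleR_2)
    ultimately show ?thesis by blast
  qed
  then have "convex hull S \<subseteq> ?H"
    by (intro hull_minimal subsetI convex_scaling) (auto simp: newton_polytope_def)
  moreover have "Poly_Mapping.keys (q j) \<subseteq> K" "Poly_Mapping.keys (q j) \<subseteq> monomials n"
    using j q by (auto simp: K_def polys_def)
  ultimately show ?thesis
    using S(2) unfolding half_newton_def by blast
qed

section \<open>SOS bases\<close>

lemma gram_term:
  "mono_poly \<alpha> * const_poly r * mono_poly \<beta> = Poly_Mapping.single (\<alpha> + \<beta>) r"
  by (simp add: mono_poly_def const_poly_def mult_single)

text \<open>The matrix \<open>Q\<close> is the sum of the outer products of the coefficient vectors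
  of the \<open>q i\<close>, so its quadratic form is a sum of squares. Summing over the half Newton
  polytope loses no coefficient because it contains every support.\<close>

lemma sos_basis_half_newton:
  assumes "sum_of_squares n p" "finite (half_newton n p)"
  shows "sos_basis p (half_newton n p)"
proof -
  let ?B = "half_newton n p"
  obtain k :: nat and q where q: "\<And>i. i < k \<Longrightarrow> q i \<in> polys n" and p: "p = (\<Sum>i<k. (q i)\<^sup>2)"
    using assms(1) unfolding sum_of_squares_def by blast
  let ?l = "\<lambda>i. Poly_Mapping.lookup (q i)"
  define Q where "Q \<alpha> \<beta> = (\<Sum>i<k. ?l i \<alpha> * ?l i \<beta>)" for \<alpha> \<beta>
  have single_sum: "Poly_Mapping.single \<gamma> (\<Sum>i<k. f i) = (\<Sum>i<k. Poly_Mapping.single \<gamma> (f i))"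
    for \<gamma> :: expo and f :: "nat \<Rightarrow> real"
    by (induction k) (simp_all add: single_add)
  have "(\<Sum>i<k. (q i)\<^sup>2) = (\<Sum>i<k. \<Sum>\<alpha>\<in>?B. \<Sum>\<beta>\<in>?B. Poly_Mapping.single (\<alpha> + \<beta>) (?l i \<alpha> * ?l i \<beta>))"
    using keys_subset_half_newton[OF q p] by (intro sum.cong refl square_expand assms(2)) auto
  also have "\<dots> = (\<Sum>\<alpha>\<in>?B. \<Sum>i<k. \<Sum>\<beta>\<in>?B. Poly_Mapping.single (\<alpha> + \<beta>) (?l i \<alpha> * ?l i \<beta>))"
    by (rule sum.swap)
  also have "\<dots> = (\<Sum>\<alpha>\<in>?B. \<Sum>\<beta>\<in>?B. mono_poly \<alpha> * const_poly (Q \<alpha> \<beta>) * mono_poly \<beta>)"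
    unfolding gram_term Q_def single_sum by (intro sum.cong refl sum.swap)
  finally have "p = (\<Sum>\<alpha>\<in>?B. \<Sum>\<beta>\<in>?B. mono_poly \<alpha> * const_poly (Q \<alpha> \<beta>) * mono_poly \<beta>)"
    using p by simp
  moreover have "psd_on ?B Q"
    unfolding psd_on_def
  proof (intro conjI ballI allI)
    show "Q \<alpha> \<beta> = Q \<beta> \<alpha>" for \<alpha> \<beta>
      by (simp add: Q_def mult.commute)
    fix v
    have "(\<Sum>\<alpha>\<in>?B. \<Sum>\<beta>\<in>?B. v \<alpha> * Q \<alpha> \<beta> * v \<beta>) =
        (\<Sum>\<alpha>\<in>?B. \<Sum>\<beta>\<in>?B. \<Sum>i<k. (v \<alpha> * ?l i \<alpha>) * (v \<beta> * ?l i \<beta>))"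
      by (simp add: Q_def sum_distrib_left sum_distrib_right algebra_simps)
    also have "\<dots> = (\<Sum>\<alpha>\<in>?B. \<Sum>i<k. \<Sum>\<beta>\<in>?B. (v \<alpha> * ?l i \<alpha>) * (v \<beta> * ?l i \<beta>))"
      by (intro sum.cong refl sum.swap)
    also have "\<dots> = (\<Sum>i<k. \<Sum>\<alpha>\<in>?B. \<Sum>\<beta>\<in>?B. (v \<alpha> * ?l i \<alpha>) * (v \<beta> * ?l i \<beta>))"
      by (rule sum.swap)
    also have "\<dots> = (\<Sum>i<k. (\<Sum>\<alpha>\<in>?B. v \<alpha> * ?l i \<alpha>)\<^sup>2)"
      by (simp add: power2_eq_square sum_product)
    finally show "0 \<le> (\<Sum>\<alpha>\<in>?B. \<Sum>\<beta>\<in>?B. v \<alpha> * Q \<alpha> \<beta> * v \<beta>)"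
      by (simp add: sum_nonneg)
  qed
  ultimately show ?thesis
    unfolding sos_basis_def using assms(2) by blast
qed

lemma double_sum_extend:
  fixes f :: "'a \<Rightarrow> 'a \<Rightarrow> 'b::comm_monoid_add"
  assumes "finite C" "B \<subseteq> C" "\<And>\<alpha> \<beta>. \<alpha> \<notin> B \<or> \<beta> \<notin> B \<Longrightarrow> f \<alpha> \<beta> = 0"
  shows "(\<Sum>\<alpha>\<in>C. \<Sum>\<beta>\<in>C. f \<alpha> \<beta>) = (\<Sum>\<alpha>\<in>B. \<Sum>\<beta>\<in>B. f \<alpha> \<beta>)"
proof -
  have "(\<Sum>\<alpha>\<in>C. \<Sum>\<beta>\<in>C. f \<alpha> \<beta>) = (\<Sum>\<alpha>\<in>C. \<Sum>\<beta>\<in>B. f \<alpha> \<beta>)"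
    using assms by (intro sum.cong refl sum.mono_neutral_right) auto
  also have "\<dots> = (\<Sum>\<alpha>\<in>B. \<Sum>\<beta>\<in>B. f \<alpha> \<beta>)"
    using assms by (intro sum.mono_neutral_right) auto
  finally show ?thesis .
qed

text \<open>Padding the Gram matrix with zeros changes neither the represented polynomial nor the
  values of the quadratic form.\<close>

lemma sos_basis_mono:
  assumes "sos_basis p B" "B \<subseteq> C" "finite C"
  shows "sos_basis p C"
proof -
  obtain Q where Q: "psd_on B Q"
    and p: "p = (\<Sum>\<alpha>\<in>B. \<Sum>\<beta>\<in>B. mono_poly \<alpha> * const_poly (Q \<alpha> \<beta>) * mono_poly \<beta>)"
    using assms(1) unfolding sos_basis_def by blast
  define R where "R \<alpha> \<beta> = (if \<alpha> \<in> B \<and> \<beta> \<in> B then Q \<alpha> \<beta> else 0)" for \<alpha> \<beta>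
  have "(\<Sum>\<alpha>\<in>C. \<Sum>\<beta>\<in>C. mono_poly \<alpha> * const_poly (R \<alpha> \<beta>) * mono_poly \<beta>) =
      (\<Sum>\<alpha>\<in>B. \<Sum>\<beta>\<in>B. mono_poly \<alpha> * const_poly (R \<alpha> \<beta>) * mono_poly \<beta>)"
    by (intro double_sum_extend assms) (auto simp: R_def const_poly_def)
  also have "\<dots> = p"
    unfolding p by (intro sum.cong refl) (simp add: R_def)
  finally have "p = (\<Sum>\<alpha>\<in>C. \<Sum>\<beta>\<in>C. mono_poly \<alpha> * const_poly (R \<alpha> \<beta>) * mono_poly \<beta>)" ..
  moreover have "psd_on C R"
    unfolding psd_on_def
  proof (intro conjI ballI allI)
    show "R \<alpha> \<beta> = R \<beta> \<alpha>" for \<alpha> \<beta>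
      using Q by (auto simp: R_def psd_on_def)
    fix v
    have "(\<Sum>\<alpha>\<in>C. \<Sum>\<beta>\<in>C. v \<alpha> * R \<alpha> \<beta> * v \<beta>) = (\<Sum>\<alpha>\<in>B. \<Sum>\<beta>\<in>B. v \<alpha> * R \<alpha> \<beta> * v \<beta>)"
      by (intro double_sum_extend assms) (auto simp: R_def)
    also have "\<dots> = (\<Sum>\<alpha>\<in>B. \<Sum>\<beta>\<in>B. v \<alpha> * Q \<alpha> \<beta> * v \<beta>)"
      by (intro sum.cong refl) (simp add: R_def)
    finally show "0 \<le> (\<Sum>\<alpha>\<in>C. \<Sum>\<beta>\<in>C. v \<alpha> * R \<alpha> \<beta> * v \<beta>)"
      using Q by (simp add: psd_on_def)
  qed
  ultimately show ?thesis
    unfolding sos_basis_def using assms(3) by blast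
qed

section \<open>Feasible prefixes and the coverage rank\<close>

text \<open>The whole list is feasible, so the \<open>LEAST\<close> is attained; monotonicity in the
  basis makes every longer prefix feasible as well.\<close>

lemma
  assumes "sos_basis p (set u)" "u \<noteq> []"
  shows coverage_rank_le_length: "coverage_rank p u \<le> length u"
    and sos_basis_take_iff: "1 \<le> m \<Longrightarrow> sos_basis p (set (take m u)) \<longleftrightarrow> coverage_rank p u \<le> m"
proof -
  let ?P = "\<lambda>j. 1 \<le> j \<and> j \<le> length u \<and> sos_basis p (set (take j u))"
  have "?P (length u)"
    using assms by (simp add: Suc_le_eq)
  then have rank: "?P (coverage_rank p u)"
    unfolding coverage_rank_def by (rule LeastI)
  then show le: "coverage_rank p u \<le> length u" by simp
  assume "1 \<le> m"
  show "sos_basis p (set (take m u)) \<longleftrightarrow> coverage_rank p u \<le> m"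
  proof
    assume m: "sos_basis p (set (take m u))"
    show "coverage_rank p u \<le> m"
    proof (cases "m \<le> length u")
      case True
      then show ?thesis
        unfolding coverage_rank_def using m \<open>1 \<le> m\<close> by (intro Least_le) simp
    next
      case False
      \<comment> \<open>Indices beyond the length are outside the range of the \<open>LEAST\<close>,
        but they exceed the rank anyway.\<close>
      then show ?thesis using le by simp
    qed
  next
    assume "coverage_rank p u \<le> m"
    then show "sos_basis p (set (take m u))"
      using rank sos_basis_mono[OF _ set_take_subset_set_take finite_set] by blast
  qed
qed

section \<open>The geometric schedule\<close>

text \<open>The tail is again a schedule, started at its own head; this drives both inductions
  below.\<close>

lemma geometric_schedule_Cons_Cons:
  assumes "geometric_schedule N \<rho> m0 (m # m' # ms)"
  shows "m0 = m" "m' = min N (nat \<lceil>\<rho> * real m\<rceil>)" "geometric_schedule N \<rho> m' (m' # ms)"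
proof -
  note sched = assms[unfolded geometric_schedule_def]
  have step: "(m # m' # ms) ! Suc i = min N (nat \<lceil>\<rho> * real ((m # m' # ms) ! i)\<rceil>)"
    if "Suc i < length (m # m' # ms)" for i
    using sched that by blast
  show "m0 = m" using sched by simp
  show "m' = min N (nat \<lceil>\<rho> * real m\<rceil>)" using step[of 0] by simp
  show "geometric_schedule N \<rho> m' (m' # ms)"
    unfolding geometric_schedule_def
  proof (intro conjI allI impI)
    fix i assume "Suc i < length (m' # ms)"
    then show "(m' # ms) ! Suc i = min N (nat \<lceil>\<rho> * real ((m' # ms) ! i)\<rceil>)"
      using step[of "Suc i"] by simp
  qed (use sched in auto)
qed

text \<open>Rounding up adds at most \<open>1 < \<rho>\<close>, and
  \<open>m + 1 \<le> \<eta>\<close> for integers, so the rounding is absorbed without an additive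
  term.\<close>

lemma schedule_step_le:
  assumes "1 < \<rho>" "m < (\<eta>::nat)"
  shows "real (min N (nat \<lceil>\<rho> * real m\<rceil>)) \<le> \<rho> * real \<eta>"
proof -
  have "0 \<le> \<lceil>\<rho> * real m\<rceil>"
    using assms(1) by (simp add: order_less_le_trans[of "-1" 0])
  then have "real (nat \<lceil>\<rho> * real m\<rceil>) \<le> \<rho> * real m + 1"
    by linarith
  also have "\<dots> \<le> \<rho> * real m + \<rho>"
    using assms(1) by simp
  also have "\<dots> = \<rho> * real (Suc m)"
    by (simp add: algebra_simps)
  also have "\<dots> \<le> \<rho> * real \<eta>"
    using assms by (intro mult_left_mono) auto
  finally show ?thesis by simp
qed

text \<open>A step that stays below \<open>\<eta>\<close> lowers the logarithm by at least one and
  adds one solve. The starting size is generalised for the induction along the schedule.\<close>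

lemma expansion_solves_length:
  assumes "1 < \<rho>" and feas: "\<And>m. 1 \<le> m \<Longrightarrow> sos_basis p (set (take m u)) \<longleftrightarrow> \<eta> \<le> m"
    and "\<eta> \<le> N" "geometric_schedule N \<rho> m0 ms" "1 \<le> m0" "m0 \<le> \<eta>"
  shows "int (length (expansion_solves p u ms)) \<le> 1 + \<lceil>log \<rho> (real \<eta> / real m0)\<rceil>"
  using assms(4-6)
proof (induction ms arbitrary: m0)
  case Nil
  then show ?case by (simp add: geometric_schedule_def)
next
  case (Cons m ms)
  then have m: "m0 = m" "1 \<le> m" "m \<le> \<eta>"
    by (auto simp: geometric_schedule_def)
  have pos: "0 \<le> log \<rho> (real \<eta> / real m)"
    using m assms(1) by (simp add: zero_le_log_cancel_iff)
  show ?case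
  proof (cases "m = \<eta>")
    case True
    then show ?thesis
      using m feas[of m] pos by simp
  next
    case False
    then have lt: "m < \<eta>" using m by simp
    \<comment> \<open>The schedule ends at \<open>N \<ge> \<eta>\<close>, so a size below
      \<open>\<eta>\<close> has a successor.\<close>
    then obtain m' ms' where ms: "ms = m' # ms'"
      using Cons.prems(1) assms(3) by (cases ms) (auto simp: geometric_schedule_def)
    note step = geometric_schedule_Cons_Cons[OF Cons.prems(1)[unfolded ms]]
    \<comment> \<open>Strict positivity makes the ceiling at least one, which pays for a feasible
      solve right after \<open>m\<close>.\<close>
    have logpos: "0 < log \<rho> (real \<eta> / real m)"
      using m lt assms(1) by (simp add: zero_less_log_cancel_iff)
    have m'1: "1 \<le> m'"
      using Cons.prems(1) ms by (auto simp: geometric_schedule_def)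
    show ?thesis
    proof (cases "\<eta> \<le> m'")
      case True
      then show ?thesis
        using m feas[of m'] feas[of m] m'1 logpos ms lt by simp
    next
      case False
      \<comment> \<open>Since \<open>m' < \<eta> \<le> N\<close>, the cap at \<open>N\<close> is not
        active and \<open>m'\<close> is the rounded-up product.\<close>
      then have "\<rho> * real m \<le> real m'"
        using step(2) assms(3) by linarith
      then have "log \<rho> (real \<eta> / real m') \<le> log \<rho> ((real \<eta> / real m) / \<rho>)"
        using assms(1) m m'1 lt by (subst log_le_cancel_iff) (auto simp: field_simps)
      also have "\<dots> = log \<rho> (real \<eta> / real m) - 1"
        using assms(1) m lt by (subst log_divide) auto
      finally have "\<lceil>log \<rho> (real \<eta> / real m')\<rceil> \<le> \<lceil>log \<rho> (real \<eta> / real m)\<rceil> - 1"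
        by linarith
      moreover have "int (length (expansion_solves p u ms)) \<le> 1 + \<lceil>log \<rho> (real \<eta> / real m')\<rceil>"
        using Cons.IH[of m'] step(3) m'1 False ms by simp
      ultimately show ?thesis
        using m feas[of m] lt by simp
    qed
  qed
qed

text \<open>
  The subtracted \<open>\<rho> powr (-\<omega>) * m0 powr \<omega> / (1 - \<rho> powr (-\<omega>))\<close> is the tail
  \<open>\<Sum>\<^sub>i\<^sub>\<ge>\<^sub>1 (m0 / \<rho>^i) powr \<omega>\<close> of the geometric series; it makes the induction go through.
\<close>

lemma expansion_solves_cost:
  assumes "1 < \<rho>" "0 < \<omega>"
    and feas: "\<And>m. 1 \<le> m \<Longrightarrow> sos_basis p (set (take m u)) \<longleftrightarrow> \<eta> \<le> m"
    and "\<eta> \<le> N" "geometric_schedule N \<rho> m0 ms" "1 \<le> m0" "real m0 \<le> \<rho> * real \<eta>"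
  shows "(\<Sum>m\<leftarrow>expansion_solves p u ms. real m powr \<omega>) \<le> \<rho> powr \<omega> * real \<eta> powr \<omega> +
    (real \<eta> powr \<omega> - \<rho> powr (-\<omega>) * real m0 powr \<omega>) / (1 - \<rho> powr (-\<omega>))"
  using assms(5-7)
proof (induction ms arbitrary: m0)
  case Nil
  then show ?case by (simp add: geometric_schedule_def)
next
  case (Cons m ms)
  define r where "r = \<rho> powr (-\<omega>)"
  have r: "0 < r" "r < 1"
    using assms(1,2) powr_less_cancel_iff[of \<rho> "-\<omega>" 0] by (auto simp: r_def)
  have r\<rho>: "r * \<rho> powr \<omega> = 1"
    using assms(1) by (simp add: r_def flip: powr_add)
  have m: "m0 = m" "1 \<le> m" "real m \<le> \<rho> * real \<eta>"
    using Cons.prems by (auto simp: geometric_schedule_def)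
  have top: "real x powr \<omega> \<le> \<rho> powr \<omega> * real \<eta> powr \<omega>" if "real x \<le> \<rho> * real \<eta>" for x
    using powr_mono2[of \<omega> "real x" "\<rho> * real \<eta>"] that assms(1,2) by (simp add: powr_mult)
  show ?case
  proof (cases "\<eta> \<le> m")
    case True
    \<comment> \<open>A feasible \<open>m\<close> may exceed \<open>\<eta>\<close>, but
      \<open>m \<le> \<rho> \<eta>\<close> still keeps the series term of the bound
      nonnegative.\<close>
    have "r * real m powr \<omega> \<le> r * (\<rho> powr \<omega> * real \<eta> powr \<omega>)"
      using r top[OF m(3)] by (intro mult_left_mono) auto
    also have "\<dots> = real \<eta> powr \<omega>"
      using r\<rho> by (simp flip: mult.assoc)
    finally have "0 \<le> (real \<eta> powr \<omega> - r * real m powr \<omega>) / (1 - r)"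
      using r by simp
    then show ?thesis
      using m True feas[of m] top[OF m(3)] by (simp add: r_def)
  next
    case False
    then obtain m' ms' where ms: "ms = m' # ms'"
      using Cons.prems(1) assms(4) by (cases ms) (auto simp: geometric_schedule_def)
    note step = geometric_schedule_Cons_Cons[OF Cons.prems(1)[unfolded ms]]
    have m'1: "1 \<le> m'"
      using Cons.prems(1) ms by (auto simp: geometric_schedule_def)
    have m'\<eta>: "real m' \<le> \<rho> * real \<eta>"
      using schedule_step_le[OF assms(1)] False step(2) by simp
    have sum: "(\<Sum>m\<leftarrow>expansion_solves p u (m # ms). real m powr \<omega>) =
        real m powr \<omega> + (\<Sum>m\<leftarrow>expansion_solves p u ms. real m powr \<omega>)"
      using feas[of m] m False by simp
    show ?thesis
    proof (cases "\<eta> \<le> m'")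
      case True
      have "real m powr \<omega> \<le> real \<eta> powr \<omega>"
        using False assms(2) by (intro powr_mono2) auto
      then have "real m powr \<omega> \<le> (real \<eta> powr \<omega> - r * real m powr \<omega>) / (1 - r)"
        using r by (simp add: pos_le_divide_eq algebra_simps)
      moreover have "(\<Sum>m\<leftarrow>expansion_solves p u ms. real m powr \<omega>) = real m' powr \<omega>"
        using feas[of m'] m'1 True ms by simp
      ultimately show ?thesis
        unfolding sum m(1) r_def[symmetric] using top[OF m'\<eta>] by linarith
    next
      case False
      then have "\<rho> * real m \<le> real m'"
        using step(2) assms(4) by linarith
      then have "(\<rho> * real m) powr \<omega> \<le> real m' powr \<omega>"
        using assms(1,2) by (intro powr_mono2) auto
      then have "r * (\<rho> powr \<omega> * real m powr \<omega>) \<le> r * real m' powr \<omega>"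
        using r assms(1) by (simp add: powr_mult)
      then have "real m powr \<omega> \<le> r * real m' powr \<omega>"
        using r\<rho> by (simp flip: mult.assoc)
      then have "(real \<eta> powr \<omega> - r * real m' powr \<omega>) / (1 - r)
          \<le> (real \<eta> powr \<omega> - real m powr \<omega>) / (1 - r)"
        using r by (intro divide_right_mono) auto
      \<comment> \<open>Trading \<open>r * m' powr \<omega>\<close> for the smaller
        \<open>m powr \<omega>\<close> leaves exactly the room for the solve of size
        \<open>m\<close>.\<close>
      also have "\<dots> = (real \<eta> powr \<omega> - r * real m powr \<omega>) / (1 - r) - real m powr \<omega>"
        using r by (simp add: field_simps)
      finally show ?thesis
        unfolding sum m(1) r_def[symmetric]
        using Cons.IH[of m'] step(3) m'1 m'\<eta> ms by (simp add: r_def)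
    qed
  qed
qed

lemma expansion_solves_subset: "set (expansion_solves p u ms) \<subseteq> set ms"
  by (induction ms) auto

lemma geometric_schedule_ge:
  assumes "geometric_schedule N \<rho> m0 ms" "m \<in> set ms"
  shows "m0 \<le> m"
  using assms by (cases ms) (auto simp: geometric_schedule_def)

section \<open>Both bounds for the expansion procedure\<close>

theorem lemma3:
  fixes a b :: real
  assumes "0 < a" and "a \<le> b"
  shows "\<exists>C>0. \<forall>(n::nat) (p::rpoly) (N::nat) (\<omega>::real) (c::nat \<Rightarrow> real) (B::expo set) (m1::nat)
           (u::expo list) (\<eta>::nat) (\<rho>::real) (ms::nat list).
      p \<in> polys n \<longrightarrow> p \<noteq> 0 \<longrightarrow> sum_of_squares n p \<longrightarrow>
      N = card (half_newton n p) \<longrightarrow>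
      0 < \<omega> \<longrightarrow>
      (\<forall>m\<ge>1. a * real m powr \<omega> \<le> c m \<and> c m \<le> b * real m powr \<omega>) \<longrightarrow>
      B \<subseteq> half_newton n p \<longrightarrow> coverage_repaired p B \<longrightarrow>
      m1 = card B \<longrightarrow> 1 \<le> m1 \<longrightarrow>
      distinct u \<longrightarrow> set u = half_newton n p \<longrightarrow> set (take m1 u) = B \<longrightarrow>
      \<eta> = coverage_rank p u \<longrightarrow> m1 \<le> \<eta> \<longrightarrow>
      1 < \<rho> \<longrightarrow> geometric_schedule N \<rho> m1 ms \<longrightarrow>
        int (length (expansion_solves p u ms)) \<le> 1 + \<lceil>log \<rho> (real \<eta> / real m1)\<rceil> \<and>
        (\<Sum>m\<leftarrow>expansion_solves p u ms. c m)
          \<le> C * (\<rho> powr \<omega> / (1 - \<rho> powr (- \<omega>)) * real \<eta> powr \<omega>)"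
proof (intro exI[of _ "2 * b"] conjI allI impI)
  \<comment> \<open>The factor \<open>b\<close> comes from the cost model; the factor 2 covers the
    last solve and the geometric series, each at most \<open>?G\<close> below.\<close>
  show "0 < 2 * b" using assms by simp
  fix n :: nat and p :: rpoly and N :: nat and \<omega> :: real and c :: "nat \<Rightarrow> real"
    and B :: "expo set" and m1 :: nat and u :: "expo list" and \<eta> :: nat and \<rho> :: real
    and ms :: "nat list"
  assume sos: "sum_of_squares n p" and N: "N = card (half_newton n p)" and \<omega>: "0 < \<omega>"
    and c: "\<forall>m\<ge>1. a * real m powr \<omega> \<le> c m \<and> c m \<le> b * real m powr \<omega>"
    and B: "B \<subseteq> half_newton n p" "m1 = card B" "1 \<le> m1"
    and u: "distinct u" "set u = half_newton n p"
    and \<eta>: "\<eta> = coverage_rank p u" "m1 \<le> \<eta>"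
    and \<rho>: "1 < \<rho>" and sched: "geometric_schedule N \<rho> m1 ms"
  \<comment> \<open>The half Newton polytope is finite because the list \<open>u\<close> enumerates
    it.\<close>
  have basis: "sos_basis p (set u)"
    using sos_basis_half_newton[OF sos] u(2) by (metis finite_set)
  have ne: "u \<noteq> []"
    using B u(2) by auto
  have feas: "sos_basis p (set (take m u)) \<longleftrightarrow> \<eta> \<le> m" if "1 \<le> m" for m
    using sos_basis_take_iff[OF basis ne that] \<eta>(1) by simp
  have \<eta>N: "\<eta> \<le> N"
    using coverage_rank_le_length[OF basis ne] \<eta>(1) N u by (metis distinct_card)
  show "int (length (expansion_solves p u ms)) \<le> 1 + \<lceil>log \<rho> (real \<eta> / real m1)\<rceil>"
    by (rule expansion_solves_length[OF \<rho> feas \<eta>N sched B(3) \<eta>(2)])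
  define r where "r = \<rho> powr (-\<omega>)"
  have r: "0 < r" "r < 1"
    using \<rho> \<omega> powr_less_cancel_iff[of \<rho> "-\<omega>" 0] by (auto simp: r_def)
  have \<rho>\<omega>: "1 \<le> \<rho> powr \<omega>"
    using \<rho> \<omega> by (simp add: ge_one_powr_ge_zero)
  let ?E = "real \<eta> powr \<omega>"
  let ?G = "\<rho> powr \<omega> / (1 - r) * ?E"
  have "real m1 \<le> \<rho> * real \<eta>"
    using \<eta>(2) \<rho> mult_mono[of 1 \<rho> "real m1" "real \<eta>"] by simp
  then have "(\<Sum>m\<leftarrow>expansion_solves p u ms. real m powr \<omega>)
      \<le> \<rho> powr \<omega> * ?E + (?E - r * real m1 powr \<omega>) / (1 - r)"
    unfolding r_def by (intro expansion_solves_cost[OF \<rho> \<omega> feas \<eta>N sched B(3)])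
  \<comment> \<open>The first summand uses \<open>1 - r < 1\<close>; the second drops the subtracted
    tail and uses \<open>1 \<le> \<rho> powr \<omega>\<close>.\<close>
  also have "\<dots> \<le> ?G + ?G"
  proof (rule add_mono)
    have "(\<rho> powr \<omega> * ?E) * (1 - r) \<le> (\<rho> powr \<omega> * ?E) * 1"
      using r by (intro mult_left_mono) auto
    then show "\<rho> powr \<omega> * ?E \<le> ?G"
      using r by (simp add: pos_le_divide_eq)
    have "?E - r * real m1 powr \<omega> \<le> 1 * ?E"
      using r by simp
    also have "\<dots> \<le> \<rho> powr \<omega> * ?E"
      using \<rho>\<omega> by (intro mult_right_mono) auto
    finally show "(?E - r * real m1 powr \<omega>) / (1 - r) \<le> ?G"
      using r by (simp add: divide_right_mono)
  qed
  finally have pow: "(\<Sum>m\<leftarrow>expansion_solves p u ms. real m powr \<omega>) \<le> 2 * ?G" by simp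
  have "(\<Sum>m\<leftarrow>expansion_solves p u ms. c m) \<le> (\<Sum>m\<leftarrow>expansion_solves p u ms. b * real m powr \<omega>)"
  proof (rule sum_list_mono)
    fix m assume "m \<in> set (expansion_solves p u ms)"
    \<comment> \<open>The cost model speaks only of positive sizes, and no size is below the first
      one.\<close>
    then have "1 \<le> m"
      using expansion_solves_subset geometric_schedule_ge[OF sched] B(3) by (meson order_trans subsetD)
    then show "c m \<le> b * real m powr \<omega>" using c by blast
  qed
  also have "\<dots> = b * (\<Sum>m\<leftarrow>expansion_solves p u ms. real m powr \<omega>)"
    by (simp add: sum_list_const_mult)
  also have "\<dots> \<le> b * (2 * ?G)"
    using pow assms by (intro mult_left_mono) auto
  finally show "(\<Sum>m\<leftarrow>expansion_solves p u ms. c m)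
      \<le> 2 * b * (\<rho> powr \<omega> / (1 - \<rho> powr (- \<omega>)) * real \<eta> powr \<omega>)"
    by (simp add: r_def algebra_simps)
qed

end
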